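(* For any constant $\varepsilon \in (0,1)$, there exist edge-weighted trees for which any $(2-\varepsilon)$-spanner using $k < n/2$ Steiner points has complexity $\Omega(mn^2/k^2)$. Precisely: for every $\varepsilon\in(0,1)$ there are constants $c, C>0$ such that for all positive integers $n,m,k$ with $k<n/2$ and $m\ge Cn$ there is an edge-weighted rooted tree $T$ with $n$ leaves and $m$ vertices such that every $(2-\varepsilon)$-spanner for $T$ using $k$ Steiner points has complexity at least $c\, mn^2/k^2$.
   Context: Let $T$ be a rooted tree with positive edge weights; the sites $S$ are its leaves. The distance $d(p,q)$ between two points of $T$ is the total weight of the unique path $\pi(p,q)$ between them. A Steiner point may be any vertex of $T$ or a point in the interior of an edge; placing a Steiner point $s$ in the interior of an edge $(u,v)$ of weight $w$ replaces this edge by edges $(u,s)$ and $(s,v)$ of weights $\delta w$ and $(1-\delta)w$ for some $\delta\in(0,1)$. A spanner for $T$ with Steiner point set $\mathcal{S}$ is a graph $\mathcal{G}$ with vertex set $S\cup\mathcal{S}$; its edges are called links. A link $(p,q)$ represents the path $\pi(p,q)$: its length is $d(p,q)$ and its complexity is the number of edges of $\pi(p,q)$. $\mathcal{G}$ is a $\tau$-spanner if $d_{\mathcal{G}}(p,q)\le \tau\, d(p,q)$ for all sites $p,q\in S$, where $d_{\mathcal G}$ is the shortest-path distance in $\mathcal{G}$ (no requirement is made for distances involving Steiner points). The complexity of $\mathcal{G}$ is the sum of the complexities of its links. *)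

theory Defs
  imports Complex_Main "Graph_Theory.Graph_Theory"
begin

text \<open>
  Undirected graphs are symmetric loop-free pair digraphs (\<open>pair_graph\<close>): an edge is a pair of
  opposite arcs.
\<close>

locale weighted_rooted_tree = pair_graph T for T :: "'a pair_pre_digraph" +
  fixes r :: 'a and w :: "('a \<times> 'a) weight_fun"
  assumes root_in_verts: "r \<in> pverts T"
    and unique_apath: "\<lbrakk>u \<in> pverts T; v \<in> pverts T\<rbrakk> \<Longrightarrow> \<exists>!p. apath u p v"
    and weight_pos: "e \<in> parcs T \<Longrightarrow> w e > 0"
    and weight_sym: "(u, v) \<in> parcs T \<Longrightarrow> w (u, v) = w (v, u)"

text \<open>
  A leaf is a vertex without children; the only neighbour of a non-root leaf is its parent.
  In particular a root of degree 1 is not a leaf.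
\<close>

definition sites :: "'a pair_pre_digraph \<Rightarrow> 'a \<Rightarrow> 'a set" where
  "sites T r = {v \<in> pverts T. out_degree (with_proj T) v = (if v = r then 0 else 1)}"

definition tree_path :: "'a pair_pre_digraph \<Rightarrow> 'a \<Rightarrow> 'a \<Rightarrow> ('a \<times> 'a) awalk" where
  "tree_path T u v = (THE p. pre_digraph.apath (with_proj T) u p v)"

definition tree_dist :: "'a pair_pre_digraph \<Rightarrow> ('a \<times> 'a) weight_fun \<Rightarrow> 'a \<Rightarrow> 'a \<Rightarrow> real" where
  "tree_dist T w u v = wf_digraph.awalk_cost w (tree_path T u v)"

text \<open>
  \<open>steiner_subdivision T w T' w'\<close>: the weighted tree \<open>(T', w')\<close> arises from \<open>(T, w)\<close> by placing
  finitely many points, one after the other, in the interior of edges. New points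
  are fresh elements of \<open>'a\<close>, so all subdivisions (up to isomorphism) are covered if \<open>'a\<close> is infinite.
\<close>

inductive steiner_subdivision ::
  "'a pair_pre_digraph \<Rightarrow> ('a \<times> 'a) weight_fun \<Rightarrow>
   'a pair_pre_digraph \<Rightarrow> ('a \<times> 'a) weight_fun \<Rightarrow> bool"
  for T :: "'a pair_pre_digraph" and w :: "('a \<times> 'a) weight_fun"
where
  base: "steiner_subdivision T w T w"
| place: "\<lbrakk>steiner_subdivision T w H f; (u, v) \<in> parcs H; s \<notin> pverts H; 0 < \<delta>; \<delta> < 1\<rbrakk> \<Longrightarrow>
    steiner_subdivision T w (subdivide H (u, v) s)
      (f((u, s) := \<delta> * f (u, v), (s, u) := \<delta> * f (u, v),
         (s, v) := (1 - \<delta>) * f (u, v), (v, s) := (1 - \<delta>) * f (u, v)))"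

text \<open>
  \<open>G\<close> is a spanner for \<open>T\<close> with Steiner point set \<open>X\<close>, where \<open>(T', w')\<close> is \<open>(T, w)\<close> with its edges
  subdivided at the Steiner points that are not vertices of \<open>T\<close>.
\<close>

definition steiner_spanner ::
  "real \<Rightarrow> 'a pair_pre_digraph \<Rightarrow> 'a \<Rightarrow> ('a \<times> 'a) weight_fun \<Rightarrow> 'a set \<Rightarrow>
   'a pair_pre_digraph \<Rightarrow> ('a \<times> 'a) weight_fun \<Rightarrow> 'a pair_pre_digraph \<Rightarrow> bool"
where
  "steiner_spanner \<tau> T r w X T' w' G \<longleftrightarrow>
     steiner_subdivision T w T' w' \<and>
     pverts T' - pverts T \<subseteq> X \<and> X \<subseteq> pverts T' \<and>
     pair_graph G \<and> pverts G = sites T r \<union> X \<and>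
     (\<forall>p \<in> sites T r. \<forall>q \<in> sites T r.
        wf_digraph.\<mu> (with_proj G) (\<lambda>(x, y). tree_dist T' w' x y) p q
          \<le> ereal (\<tau> * tree_dist T' w' p q))"

text \<open>Every link is a pair of opposite arcs of \<open>G\<close>, whence the factor 1/2.\<close>

definition spanner_complexity :: "'a pair_pre_digraph \<Rightarrow> 'a pair_pre_digraph \<Rightarrow> real" where
  "spanner_complexity T' G = (\<Sum>(x, y) \<in> parcs G. real (length (tree_path T' x y))) / 2"

end

theory Submission
  imports Defs
begin

text \<open>
  The tree is a caterpillar whose long spine is cut into \<open>2k\<close> groups, with about \<open>n/(4k)\<close> leaves
  attached to either end of every group. Leaf edges have weight 1, a spine path within a group has
  total weight less than \<open>\<epsilon>\<close>, and different groups are at distance at least 8. Hence a Steiner point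
  is near the leaves of at most one group, and at least \<open>k\<close> groups have no Steiner point nearby. In
  such a group every detour, through another leaf (\<open>2 + 2\<close>) or through a Steiner point, costs at
  least 4, more than \<open>(2 - \<epsilon>)(2 + \<epsilon>)\<close>, so all pairs of a left and a
  right leaf are linked directly. This yields \<open>k (n/k)\<^sup>2\<close> links of complexity \<open>m/k\<close>, up to constants.
  If \<open>n \<le> 4k\<close>, the bound is only of order \<open>m\<close> and follows from the connectivity of the spanner.
\<close>

section \<open>Trees with unique paths\<close>

text \<open>Shared setting for the original and the subdivided tree. The weight \<open>f\<close>
  stays an argument of the lemmas, so that they can be used with real weights and with unit
  weights.\<close>

locale unique_path_graph = pair_graph T for T :: "'a pair_pre_digraph" +
  assumes unique_apath: "\<lbrakk>u \<in> pverts T; v \<in> pverts T\<rbrakk> \<Longrightarrow> \<exists>!p. apath u p v"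
begin

lemma tree_path_apath:
  assumes "u \<in> pverts T" "v \<in> pverts T"
  shows "apath u (tree_path T u v) v"
  unfolding tree_path_def using unique_apath[OF assms] by (rule theI')

lemma tree_path_eqI:
  assumes "apath u p v"
  shows "tree_path T u v = p"
proof -
  have "u \<in> pverts T" "v \<in> pverts T"
    using assms by (auto simp: apath_def)
  then show ?thesis
    using unique_apath[of u v] tree_path_apath[of u v] assms by blast
qed

lemma tree_dist_self:
  assumes "u \<in> pverts T"
  shows "tree_dist T f u u = 0"
proof -
  have "tree_path T u u = []"
    using assms by (intro tree_path_eqI) (simp add: apath_Nil_iff)
  then show ?thesis by (simp add: tree_dist_def)
qed

text \<open>With unit weights the distance is the complexity of a link, so the triangle inequality
  and the potential bounds below also control complexities.\<close>

lemma tree_dist_one: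
  "tree_dist T (\<lambda>_. 1) u v = real (length (tree_path T u v))"
  by (simp add: tree_dist_def awalk_cost_def sum_list_triv)

lemma tree_dist_nonneg:
  assumes "u \<in> pverts T" "v \<in> pverts T" and "\<And>e. e \<in> parcs T \<Longrightarrow> 0 \<le> f e"
  shows "0 \<le> tree_dist T f u v"
  unfolding tree_dist_def
  using pos_cost_pos_awalk_cost[OF awalkI_apath[OF tree_path_apath]] assms by auto

text \<open>Cutting cycles of nonnegative cost out of a walk leaves a simple path, which by
  uniqueness is the tree path.\<close>

lemma tree_dist_le_awalk_cost:
  assumes "awalk u p v" and nonneg: "\<And>e. e \<in> parcs T \<Longrightarrow> 0 \<le> f e"
  shows "tree_dist T f u v \<le> awalk_cost f p"
proof -
  have "tree_path T u v = awalk_to_apath p"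
    using assms by (intro tree_path_eqI apath_awalk_to_apath)
  moreover have "awalk_cost f (awalk_to_apath p) \<le> awalk_cost f p"
    using assms(1)
  proof (rule awalk_to_path_no_neg_cyc_cost)
    show "\<not> (\<exists>x c. awalk x c x \<and> x \<in> set (awalk_verts u p) \<and> awalk_cost f c < 0)"
      using pos_cost_pos_awalk_cost[of _ _ _ f] nonneg by (metis not_less)
  qed
  ultimately show ?thesis by (simp add: tree_dist_def)
qed

lemma tree_dist_triangle:
  assumes "u \<in> pverts T" "v \<in> pverts T" "x \<in> pverts T"
    and "\<And>e. e \<in> parcs T \<Longrightarrow> 0 \<le> f e"
  shows "tree_dist T f u x \<le> tree_dist T f u v + tree_dist T f v x"
proof -
  have "awalk u (tree_path T u v @ tree_path T v x) x"
    using assms by (intro awalk_appendI) (auto intro: awalkI_apath tree_path_apath)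
  from tree_dist_le_awalk_cost[of _ _ _ f, OF this assms(4)] show ?thesis
    by (simp add: tree_dist_def)
qed

lemma awalk_cost_rev_path:
  assumes "set p \<subseteq> parcs T" and "\<And>x y. (x, y) \<in> parcs T \<Longrightarrow> f (x, y) = f (y, x)"
  shows "awalk_cost f (rev_path p) = awalk_cost f p"
  using assms(1)
proof (induction p)
  case (Cons e es)
  then show ?case using assms(2)[of "fst e" "snd e"] by simp
qed simp

lemma tree_dist_commute:
  assumes "u \<in> pverts T" "v \<in> pverts T"
    and "\<And>x y. (x, y) \<in> parcs T \<Longrightarrow> f (x, y) = f (y, x)"
  shows "tree_dist T f u v = tree_dist T f v u"
proof -
  have p: "apath u (tree_path T u v) v" using assms by (simp add: tree_path_apath)
  then have "tree_path T v u = rev_path (tree_path T u v)"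
    by (intro tree_path_eqI) simp
  moreover have "set (tree_path T u v) \<subseteq> parcs T" using p by (auto simp: apath_def)
  ultimately show ?thesis
    using awalk_cost_rev_path assms(3) by (metis tree_dist_def)
qed

text \<open>The differences of \<phi> telescope along the walk. Lower bounds on distances and hop
  counts in the caterpillar come from a suitable potential \<phi>.\<close>

lemma lipschitz_le_awalk_cost:
  fixes \<phi> :: "'a \<Rightarrow> real"
  assumes "awalk u p v" and "\<And>x y. (x, y) \<in> parcs T \<Longrightarrow> \<phi> y - \<phi> x \<le> f (x, y)"
  shows "\<phi> v - \<phi> u \<le> awalk_cost f p"
  using assms(1)
proof (induction p arbitrary: u)
  case (Cons e es)
  from Cons.prems have "e \<in> parcs T" "u = fst e" "awalk (snd e) es v"
    by (auto simp: awalk_Cons_iff)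
  with Cons.IH[of "snd e"] assms(2)[of "fst e" "snd e"] show ?case by simp
qed (simp add: awalk_Nil_iff)

lemma lipschitz_le_tree_dist:
  fixes \<phi> :: "'a \<Rightarrow> real"
  assumes "u \<in> pverts T" "v \<in> pverts T"
    and "\<And>x y. (x, y) \<in> parcs T \<Longrightarrow> \<phi> y - \<phi> x \<le> f (x, y)"
  shows "\<phi> v - \<phi> u \<le> tree_dist T f u v"
  unfolding tree_dist_def
  using lipschitz_le_awalk_cost[of u _ v \<phi> f] assms tree_path_apath awalkI_apath by metis

text \<open>Iterated triangle inequality: a link costs the tree distance of its ends, so no walk in
  a spanner is shorter than the tree path.\<close>

lemma tree_dist_le_link_cost:
  assumes "pair_wf_digraph G" "pverts G \<subseteq> pverts T"
    and "pre_digraph.awalk (with_proj G) u p v" and "\<And>e. e \<in> parcs T \<Longrightarrow> 0 \<le> f e"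
  shows "tree_dist T f u v \<le> (\<Sum>(x, y)\<leftarrow>p. tree_dist T f x y)"
proof -
  interpret G: pair_wf_digraph G by fact
  show ?thesis
    using assms(3)
  proof (induction p arbitrary: u)
    case Nil
    then show ?case using assms(2) by (auto simp: G.awalk_Nil_iff tree_dist_self)
  next
    case (Cons e es)
    then have e: "e \<in> parcs G" "u = fst e" "G.awalk (snd e) es v"
      by (auto simp: G.awalk_Cons_iff)
    then have "fst e \<in> pverts T" "snd e \<in> pverts T" "v \<in> pverts T"
      using assms(2) by (auto dest: G.wellformed G.awalk_last_in_verts)
    then show ?case
      using tree_dist_triangle[of u "snd e" v f] Cons.IH[of "snd e"] e assms(4)
      by (force simp: case_prod_beta)
  qed
qed

end

text \<open>A rank function \<open>h\<close> that decreases towards the root rules out cycles.\<close>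

locale parent_tree =
  fixes T :: "'a pair_pre_digraph" and r :: 'a and par :: "'a \<Rightarrow> 'a" and h :: "'a \<Rightarrow> real"
  assumes finite_verts: "finite (pverts T)"
    and root_in: "r \<in> pverts T"
    and par_in: "v \<in> pverts T - {r} \<Longrightarrow> par v \<in> pverts T"
    and par_less: "v \<in> pverts T - {r} \<Longrightarrow> h (par v) < h v"
    and parcs_eq: "parcs T = (\<Union>v\<in>pverts T - {r}. {(v, par v), (par v, v)})"
begin

lemma arc_iff:
  "(u, v) \<in> parcs T \<longleftrightarrow>
     u \<in> pverts T - {r} \<and> v = par u \<or> v \<in> pverts T - {r} \<and> u = par v"
  by (auto simp: parcs_eq)

sublocale pair_graph T
proof
  show "finite (parcs T)" using finite_verts by (auto simp: parcs_eq)
  show "symmetric (with_proj T)"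
    by (auto simp: symmetric_def sym_def arc_iff)
  show "fst e \<noteq> snd e" if "e \<in> parcs T" for e
    using that par_less by (fastforce simp: parcs_eq)
  show "fst e \<in> pverts T" "snd e \<in> pverts T" if e: "e \<in> parcs T" for e
  proof -
    obtain v where "v \<in> pverts T - {r}" "e = (v, par v) \<or> e = (par v, v)"
      using e by (auto simp: parcs_eq)
    then show "fst e \<in> pverts T" "snd e \<in> pverts T" using par_in[of v] by auto
  qed
qed (fact finite_verts)

text \<open>After a first step down from \<open>c\<close> to \<open>d\<close>, the parent of
  \<open>d\<close> is the visited vertex \<open>c\<close>. Hence the path can never turn upwards,
  and ranks increase along it.\<close>

lemma apath_descending:
  assumes "apath c p v" "c \<in> pverts T - {r}" "par c \<notin> set (pawalk_verts c p)"
  shows "h c \<le> h v"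
  using assms
proof (induction p arbitrary: c)
  case (Cons e es)
  obtain d where e: "e = (c, d)" "(c, d) \<in> parcs T" "apath d es v" "c \<notin> set (pawalk_verts d es)"
    using Cons.prems(1) by (cases e) (auto simp: apath_Cons_iff)
  have "d \<in> set (pawalk_verts d es)" using e by (cases es) (auto simp: apath_Cons_iff)
  then have "d \<noteq> par c" using Cons.prems(3) e by auto
  then have "d \<in> pverts T - {r}" "c = par d" using e by (auto simp: arc_iff)
  then show ?case using Cons.IH[of d] e par_less[of d] by simp
qed (simp add: apath_Nil_iff)

text \<open>A first step down would force the whole path down, to a target of rank larger than that
  of \<open>u\<close>.\<close>

lemma apath_ascending:
  assumes "apath u (e # p) v" "h v \<le> h u"
  shows "e = (u, par u)"
proof -
  obtain d where e: "e = (u, d)" "(u, d) \<in> parcs T" "apath d p v" "u \<notin> set (pawalk_verts d p)"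
    using assms(1) by (cases e) (auto simp: apath_Cons_iff)
  have "\<not> (d \<in> pverts T - {r} \<and> u = par d)"
    using apath_descending[of d p v] par_less[of d] e assms(2) by auto
  then show ?thesis using e by (auto simp: arc_iff)
qed

lemma apath_unique:
  assumes "apath u p v" "apath u q v"
  shows "p = q"
  using assms
proof (induction "length p" arbitrary: u p v q rule: less_induct)
  case less
  \<comment> \<open>The case where the start has the larger rank: both first arcs go to the parent
    and can be stripped. It is separated because it is applied to the paths and to their
    reversals.\<close>
  have step: "p = q"
    if p: "apath u p v" and q: "apath u q v" and "h v \<le> h u" "length p \<le> n"
      and IH: "\<And>u p v q. length p < n \<Longrightarrow> apath u p v \<Longrightarrow> apath u q v \<Longrightarrow> p = q"
    for u p v q and n :: nat
  proof (cases "u = v")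
    case True
    then show ?thesis using p q apath_nonempty_ends by blast
  next
    case False
    then obtain e p' e' q' where eq: "p = e # p'" "q = e' # q'"
      using p q by (metis apath_Nil_iff list.exhaust)
    have "e = (u, par u)" "e' = (u, par u)"
      using apath_ascending p q that(3) unfolding eq by blast+
    then show ?thesis
      using IH[of p' "par u" v q'] p q that(4) by (simp add: eq apath_Cons_iff)
  qed
  have IH: "length p' < length p \<Longrightarrow> apath u p' v \<Longrightarrow> apath u q v \<Longrightarrow> p' = q" for u p' v q
    using less.hyps by blast
  show ?case
  proof (cases "h v \<le> h u")
    case True
    then show ?thesis using step[OF less.prems] IH by blast
  next
    case False
    have "length (rev_path p) = length p" by (induction p) auto
    then have "rev_path p = rev_path q"
      using step[of v "rev_path p" u "rev_path q" "length p"] IH False less.prems by auto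
    then show ?thesis by (simp add: rev_path_eq)
  qed
qed

text \<open>Real ranks are not well-founded, so the induction counts the vertices of smaller
  rank.\<close>

lemma awalk_to_root:
  assumes "v \<in> pverts T"
  shows "\<exists>p. awalk v p r"
  using assms
proof (induction "card {x \<in> pverts T. h x < h v}" arbitrary: v rule: less_induct)
  case less
  show ?case
  proof (cases "v = r")
    case True
    then show ?thesis using root_in by (auto simp: awalk_Nil_iff intro: exI[of _ "[]"])
  next
    case False
    then have v: "v \<in> pverts T - {r}" using less.prems by simp
    have "card {x \<in> pverts T. h x < h (par v)} < card {x \<in> pverts T. h x < h v}"
      using finite_verts par_less[OF v] par_in[OF v] by (intro psubset_card_mono) auto
    then obtain p where "awalk (par v) p r" using less.hyps par_in[OF v] by blast
    then have "awalk v ((v, par v) # p) r"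
      using v by (simp add: awalk_Cons_iff arc_iff)
    then show ?thesis ..
  qed
qed

sublocale unique_path_graph T
proof
  fix u v assume "u \<in> pverts T" "v \<in> pverts T"
  then obtain p q where "awalk u p r" "awalk v q r" using awalk_to_root by metis
  then have "awalk u (p @ rev_path q) v" by (intro awalk_appendI) auto
  then show "\<exists>!p. apath u p v"
    using apath_awalk_to_apath apath_unique by blast
qed

text \<open>The new vertex becomes the parent of \<open>c\<close> and receives the midpoint of two
  ranks, which is why ranks are real numbers.\<close>

lemma parent_tree_subdivide:
  assumes "c \<in> pverts T - {r}" "s \<notin> pverts T"
  shows "parent_tree (subdivide T (c, par c) s) r (par(s := par c, c := s))
           (h(s := (h c + h (par c)) / 2))"
proof
  have "c \<noteq> s" using assms by auto
  \<comment> \<open>No second vertex contributes the arcs between \<open>c\<close> and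
    \<open>par c\<close>; hence deleting these arcs removes exactly the contribution of
    \<open>c\<close>.\<close>
  have no2: "v \<noteq> par c \<or> par v \<noteq> c" if "v \<in> pverts T - {r}" for v
    using par_less[OF that] par_less[OF assms(1)] by auto
  let ?par = "par(s := par c, c := s)" and ?B = "pverts T - {r} - {c}"
  have verts: "pverts (subdivide T (c, par c) s) - {r} = insert s (insert c ?B)"
    using assms root_in by auto
  have "parcs T - {(c, par c), (par c, c)} = (\<Union>v\<in>?B. {(v, par v), (par v, v)})"
    unfolding parcs_eq using no2 by fastforce
  also have "\<dots> = (\<Union>v\<in>?B. {(v, ?par v), (?par v, v)})"
    using assms by (intro SUP_cong) auto
  finally show "parcs (subdivide T (c, par c) s)
      = (\<Union>v\<in>pverts (subdivide T (c, par c) s) - {r}. {(v, ?par v), (?par v, v)})"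
    unfolding verts arcs_subdivide UN_insert using \<open>c \<noteq> s\<close> by auto
qed (use assms finite_verts root_in par_in par_less[OF assms(1)] par_less in \<open>auto split: if_splits\<close>)

end

section \<open>Subdividing edges\<close>

lemma subdivide_swap: "subdivide H (u, v) s = subdivide H (v, u) s"
  by (auto simp: subdivide.simps insert_commute)

definition symmetric_positive :: "'a pair_pre_digraph \<Rightarrow> ('a \<times> 'a) weight_fun \<Rightarrow> bool" where
  "symmetric_positive T f \<longleftrightarrow> (\<forall>(x, y) \<in> parcs T. 0 < f (x, y) \<and> f (x, y) = f (y, x))"

lemma symmetric_positiveD:
  assumes "symmetric_positive T f" "(x, y) \<in> parcs T"
  shows "0 < f (x, y)" "f (x, y) = f (y, x)"
  using assms by (auto simp: symmetric_positive_def)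

lemma length_sd_path: "length p \<le> length (sd_path e s p)"
  by (cases e) (induction p, auto)

text \<open>This transfers all estimates to the original tree: distances of old vertices are
  preserved and hop counts can only grow. The parent structure is carried along because it gives
  unique paths after every subdivision.\<close>

lemma steiner_subdivision_invariant:
  assumes "steiner_subdivision T w T' w'" and "parent_tree T r par h" and "symmetric_positive T w"
  shows "\<exists>par' h'. parent_tree T' r par' h' \<and> symmetric_positive T' w' \<and> pverts T \<subseteq> pverts T' \<and>
    (\<forall>x\<in>pverts T. \<forall>y\<in>pverts T. tree_dist T' w' x y = tree_dist T w x y \<and>
       length (tree_path T x y) \<le> length (tree_path T' x y))"
  using assms
proof (induction rule: steiner_subdivision.induct)
  case base
  then show ?case by blast
next
  case (place H f u v s \<delta>)
  then obtain par' h' where IH: "parent_tree H r par' h'" "symmetric_positive H f"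
    "pverts T \<subseteq> pverts H"
    "\<forall>x\<in>pverts T. \<forall>y\<in>pverts T. tree_dist H f x y = tree_dist T w x y \<and>
       length (tree_path T x y) \<le> length (tree_path H x y)"
    by blast
  interpret H: parent_tree H r par' h' by fact
  let ?S = "subdivide H (u, v) s"
  let ?f = "f((u, s) := \<delta> * f (u, v), (s, u) := \<delta> * f (u, v),
         (s, v) := (1 - \<delta>) * f (u, v), (v, s) := (1 - \<delta>) * f (u, v))"
  \<comment> \<open>The rule may name the edge in either direction, but the parent pointer to
    redirect is that of its child end.\<close>
  obtain par'' h'' where "parent_tree ?S r par'' h''"
  proof (cases "u \<in> pverts H - {r} \<and> v = par' u")
    case True
    then show ?thesis using H.parent_tree_subdivide[of u s] place.hyps that by auto
  next
    case False
    then have "v \<in> pverts H - {r}" "u = par' v" using place.hyps by (auto simp: H.arc_iff)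
    then show ?thesis
      using H.parent_tree_subdivide[of v s] place.hyps that by (metis subdivide_swap)
  qed
  then interpret S: parent_tree ?S r par'' h'' .
  have uv: "u \<in> pverts H" "v \<in> pverts H" "u \<noteq> v"
    using place.hyps H.wellformed[of "(u, v)"] H.no_loops[of "(u, v)"] by auto
  have fresh: "(x, y) \<in> parcs H \<Longrightarrow> x \<noteq> s \<and> y \<noteq> s" for x y
    using place.hyps H.wellformed[of "(x, y)"] by auto
  have new: "u \<noteq> s" "v \<noteq> s" "0 < f (u, v)"
    using uv place.hyps symmetric_positiveD(1)[OF IH(2)] by auto
  have "0 < ?f (x, y) \<and> ?f (x, y) = ?f (y, x)" if xy: "(x, y) \<in> parcs ?S" for x y
  proof (cases "(x, y) \<in> parcs H")
    case True
    then show ?thesis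
      using fresh[OF True] symmetric_positiveD[OF IH(2) True] by simp
  next
    case False
    then have "(x, y) \<in> {(u, s), (s, u), (s, v), (v, s)}" using xy by simp
    then show ?thesis using uv(3) new place.hyps(4,5) by auto
  qed
  then have "symmetric_positive ?S ?f" by (auto simp: symmetric_positive_def simp del: fun_upd_apply)
  have old: "?f e = f e" if "e \<in> parcs H" for e
    using fresh[of "fst e" "snd e"] that by (cases e) simp
  have split: "?f (u, s) + ?f (s, v) = f (u, v)" "?f (v, s) + ?f (s, u) = f (v, u)"
    using uv(3) new symmetric_positiveD(2)[OF IH(2) place.hyps(2)] by (auto simp: algebra_simps)
  have cost: "S.awalk_cost ?f (sd_path (u, v) s q) = H.awalk_cost f q" if "set q \<subseteq> parcs H" for q
    using that
  proof (induction q)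
    case (Cons e es)
    have "S.awalk_cost ?f (sd_path (u, v) s [e]) = f e"
      using old[of e] split Cons.prems by (simp add: add.assoc[symmetric] del: fun_upd_apply)
    moreover have "sd_path (u, v) s (e # es) = sd_path (u, v) s [e] @ sd_path (u, v) s es" by simp
    ultimately show ?case
      using Cons.IH Cons.prems
      by (simp del: fun_upd_apply sd_path.simps)
  qed simp
  have dist: "tree_dist ?S ?f x y = tree_dist H f x y"
    and hops: "length (tree_path H x y) \<le> length (tree_path ?S x y)"
    if "x \<in> pverts H" "y \<in> pverts H" for x y
  proof -
    have p: "H.apath x (tree_path H x y) y" using that by (rule H.tree_path_apath)
    \<comment> \<open>Replacing the arcs of the split edge by their two halves yields a simple path,
      which is the tree path by uniqueness.\<close>
    have eq: "tree_path ?S x y = sd_path (u, v) s (tree_path H x y)"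
      using H.apath_sd_path[OF p] place.hyps by (intro S.tree_path_eqI)
    then show "length (tree_path H x y) \<le> length (tree_path ?S x y)"
      by (simp add: length_sd_path)
    have "set (tree_path H x y) \<subseteq> parcs H" using p by (auto simp: H.apath_def H.awalk_def)
    from cost[OF this] show "tree_dist ?S ?f x y = tree_dist H f x y"
      unfolding tree_dist_def eq .
  qed
  show ?case
  proof (intro exI conjI ballI)
    show "parent_tree ?S r par'' h''" by (rule S.parent_tree_axioms)
    show "symmetric_positive ?S ?f" by fact
    show "pverts T \<subseteq> pverts ?S" using IH(3) by auto
    fix x y assume xy: "x \<in> pverts T" "y \<in> pverts T"
    then have "x \<in> pverts H" "y \<in> pverts H" using IH(3) by auto
    note * = dist[OF this] hops[OF this]
    show "tree_dist ?S ?f x y = tree_dist T w x y" using *(1) IH(4) xy by simp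
    show "length (tree_path T x y) \<le> length (tree_path ?S x y)"
      using *(2) IH(4) xy le_trans by blast
  qed
qed

section \<open>The caterpillar\<close>

text \<open>
  The spine is \<open>{..<M}\<close>; leaf number \<open>j < n\<close> is the vertex \<open>M + j\<close>, attached at the spine vertex
  \<open>att j\<close>. The spine is cut into groups of \<open>D\<close> consecutive vertices, with edges of weight 8 in between.
\<close>

locale caterpillar =
  fixes M n D :: nat and att :: "nat \<Rightarrow> nat" and \<epsilon> :: real
  assumes spine_pos: "0 < M" and width_pos: "0 < D" and \<epsilon>: "0 < \<epsilon>" "\<epsilon> < 1"
    and att_less: "j < n \<Longrightarrow> att j < M"
    and att_end: "\<exists>j<n. att j = M - 1"
begin

definition pos :: "nat \<Rightarrow> nat" where
  "pos v = (if v < M then v else att (v - M))"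

definition parent :: "nat \<Rightarrow> nat" where
  "parent v = (if v < M then v - 1 else att (v - M))"

text \<open>Parents have smaller numbers than their children, so the maximum is the child end of the
  edge. On the spine, \<open>D dvd c\<close> means that \<open>c\<close> opens a new group; a group
  has only \<open>D - 1\<close> inner edges, of total weight below \<epsilon>.\<close>

definition wt :: "(nat \<times> nat) weight_fun" where
  "wt e = (let c = max (fst e) (snd e) in if M \<le> c then 1 else if D dvd c then 8 else \<epsilon> / D)"

definition tree :: "nat pair_pre_digraph" where
  "tree = \<lparr>pverts = {..<M + n}, parcs = (\<Union>v\<in>{..<M + n} - {0}. {(v, parent v), (parent v, v)})\<rparr>"

lemma pverts_tree: "pverts tree = {..<M + n}"
  by (simp add: tree_def)

lemma parent_less: "v \<in> {..<M + n} - {0} \<Longrightarrow> parent v < v \<and> parent v < M"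
  using att_less[of "v - M"] by (auto simp: parent_def less_diff_conv2)

sublocale parent_tree tree 0 parent real
  using spine_pos parent_less by unfold_locales (fastforce simp: tree_def)+

lemma wt_parent:
  "v \<in> {..<M + n} - {0} \<Longrightarrow> wt (v, parent v) = (if M \<le> v then 1 else if D dvd v then 8 else \<epsilon> / D)"
  "v \<in> {..<M + n} - {0} \<Longrightarrow> wt (parent v, v) = (if M \<le> v then 1 else if D dvd v then 8 else \<epsilon> / D)"
  using parent_less[of v] by (auto simp: wt_def Let_def max_def)

lemma arc_cases:
  assumes "(x, y) \<in> parcs tree"
  obtains c where "c \<in> {..<M + n} - {0}" "x = c \<and> y = parent c \<or> x = parent c \<and> y = c"
  using assms unfolding arc_iff pverts_tree by blast

lemma symmetric_positive_wt: "symmetric_positive tree wt"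
proof -
  have "0 < wt (x, y) \<and> wt (x, y) = wt (y, x)" if "(x, y) \<in> parcs tree" for x y
    using that \<epsilon> width_pos by (auto simp: wt_def Let_def max.commute)
  then show ?thesis by (auto simp: symmetric_positive_def)
qed

lemma wt_nonneg: "e \<in> parcs tree \<Longrightarrow> 0 \<le> wt e"
  using symmetric_positiveD(1)[OF symmetric_positive_wt, of "fst e" "snd e"] by simp

lemma weighted_rooted_tree: "weighted_rooted_tree tree 0 wt"
proof
  show "0 \<in> pverts tree" by (rule root_in)
  show "0 < wt e" if "e \<in> parcs tree" for e
    using symmetric_positiveD(1)[OF symmetric_positive_wt, of "fst e" "snd e"] that by simp
  show "wt (u, v) = wt (v, u)" if "(u, v) \<in> parcs tree" for u v
    using symmetric_positiveD(2)[OF symmetric_positive_wt that] .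
qed (rule unique_apath)

lemma sites_tree: "sites tree 0 = {M..<M + n}"
proof -
  have deg: "out_degree (with_proj tree) v = card {e \<in> parcs tree. fst e = v}" for v
    by (simp add: out_degree_def out_arcs_def)
  have fin: "finite {e \<in> parcs tree. fst e = v}" for v
    using pair_finite_arcs by simp
  have child: "\<exists>c \<in> {..<M + n} - {0}. v < c \<and> parent c = v" if "v < M" for v
  proof (cases "v + 1 < M")
    case True
    then show ?thesis by (intro bexI[of _ "v + 1"]) (auto simp: parent_def)
  next
    case False
    then have "v = M - 1" using that by simp
    \<comment> \<open>The last spine vertex has no successor on the spine; without a leaf attached
      to it, it would itself be a site or a childless root.\<close>
    with att_end obtain j where "j < n" "att j = v" by auto
    then show ?thesis using that by (intro bexI[of _ "M + j"]) (auto simp: parent_def)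
  qed
  have leaf: "out_degree (with_proj tree) v = 1" if "v \<in> {M..<M + n}" for v
  proof -
    have "{e \<in> parcs tree. fst e = v} = {(v, parent v)}"
    proof (intro set_eqI iffI)
      fix e assume "e \<in> {(v, parent v)}"
      then show "e \<in> {e \<in> parcs tree. fst e = v}"
        using that spine_pos by (auto simp: arc_iff pverts_tree)
    next
      fix e assume e: "e \<in> {e \<in> parcs tree. fst e = v}"
      then have "(v, snd e) \<in> parcs tree" by auto
      then show "e \<in> {(v, parent v)}"
      proof (cases rule: arc_cases)
        case (1 c)
        then show ?thesis using parent_less[of c] that e by (cases e) auto
      qed
    qed
    then show ?thesis by (simp add: deg)
  qed
  have root: "out_degree (with_proj tree) 0 \<noteq> 0"
  proof -
    obtain c where "c \<in> {..<M + n} - {0}" "parent c = 0" using child[OF spine_pos] by blast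
    then have "(0, c) \<in> {e \<in> parcs tree. fst e = 0}" by (auto simp: arc_iff pverts_tree)
    then show ?thesis using fin unfolding deg by (metis card_0_eq empty_iff)
  qed
  have inner: "out_degree (with_proj tree) v \<noteq> 1" if "0 < v" "v < M" for v
  proof -
    obtain c where c: "c \<in> {..<M + n} - {0}" "v < c" "parent c = v" using child[OF \<open>v < M\<close>] by blast
    then have "{(v, c), (v, parent v)} \<subseteq> {e \<in> parcs tree. fst e = v}"
      using that by (auto simp: arc_iff pverts_tree)
    from card_mono[OF fin this] have "card {(v, c), (v, parent v)} \<le> out_degree (with_proj tree) v"
      unfolding deg .
    moreover have "parent v \<noteq> c" using parent_less[of v] c(2) that by simp
    ultimately have "2 \<le> out_degree (with_proj tree) v" by simp
    then show ?thesis by simp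
  qed
  show ?thesis
  proof (intro set_eqI iffI)
    fix v assume v: "v \<in> sites tree 0"
    have deg_v: "out_degree (with_proj tree) v = (if v = 0 then 0 else 1)" and "v < M + n"
      using v by (simp_all add: sites_def pverts_tree)
    have "\<not> v < M" using deg_v root inner[of v] by (cases "v = 0") auto
    with \<open>v < M + n\<close> show "v \<in> {M..<M + n}" by simp
  next
    fix v assume v: "v \<in> {M..<M + n}"
    then have "v \<noteq> 0" "v < M + n" using spine_pos by simp_all
    with leaf[OF v] show "v \<in> sites tree 0" by (simp add: sites_def pverts_tree)
  qed
qed

section \<open>Distances and hop counts between leaves\<close>

lemma pos_parent:
  assumes "c \<in> {..<M + n} - {0}"
  shows "pos (parent c) = (if M \<le> c then pos c else c - 1)" "M \<le> c \<or> pos c = c"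
proof -
  have "att (c - M) < M" if "M \<le> c" using assms that by (intro att_less) auto
  then show "pos (parent c) = (if M \<le> c then pos c else c - 1)" "M \<le> c \<or> pos c = c"
    using assms by (auto simp: pos_def parent_def)
qed

text \<open>The potential is -1 and 1 at the two leaves and 0 elsewhere, so it changes only on their
  two leaf edges, by 1 on each.\<close>

lemma tree_dist_leaves_ge_2:
  assumes "i < n" "j < n" "i \<noteq> j"
  shows "2 \<le> tree_dist tree wt (M + i) (M + j)"
proof -
  define \<phi> :: "nat \<Rightarrow> real" where "\<phi> v = (if v = M + i then - 1 else if v = M + j then 1 else 0)" for v
  have "\<phi> (M + j) - \<phi> (M + i) \<le> tree_dist tree wt (M + i) (M + j)"
  proof (rule lipschitz_le_tree_dist)
    fix x y assume "(x, y) \<in> parcs tree"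
    then show "\<phi> y - \<phi> x \<le> wt (x, y)"
    proof (cases rule: arc_cases)
      case (1 c)
      with \<epsilon> width_pos wt_parent[of c] parent_less[of c] show ?thesis
        by (auto simp: \<phi>_def)
    qed
  qed (use assms in \<open>auto simp: pverts_tree\<close>)
  then show ?thesis using assms by (simp add: \<phi>_def)
qed

text \<open>The potential, 8 times the group number, is constant on leaf edges and inside groups and
  jumps by 8 exactly on the edges of weight 8.\<close>

lemma tree_dist_groups_ge_8:
  assumes "i < n" "j < n" "att i div D < att j div D"
  shows "8 \<le> tree_dist tree wt (M + i) (M + j)"
proof -
  define \<phi> :: "nat \<Rightarrow> real" where "\<phi> v = 8 * real (pos v div D)" for v
  have "\<phi> (M + j) - \<phi> (M + i) \<le> tree_dist tree wt (M + i) (M + j)"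
  proof (rule lipschitz_le_tree_dist)
    fix x y assume "(x, y) \<in> parcs tree"
    then show "\<phi> y - \<phi> x \<le> wt (x, y)"
    proof (cases rule: arc_cases)
      case (1 c)
      have "\<bar>\<phi> (parent c) - \<phi> c\<bar> \<le> (if M \<le> c then 1 else if D dvd c then 8 else \<epsilon> / D)"
      proof (cases "M \<le> c")
        case True
        then show ?thesis using pos_parent[of c] 1 by (simp add: \<phi>_def)
      next
        case False
        then obtain d where d: "c = Suc d" "pos c = Suc d" "pos (parent c) = d"
          using pos_parent[of c] 1 by (cases c) auto
        have "\<phi> (parent c) = 8 * real (d div D)" "\<phi> c = 8 * real (Suc d div D)"
          by (simp_all only: \<phi>_def d(2,3))
        then show ?thesis
          using False \<epsilon> width_pos d(1) by (auto simp: div_Suc mod_Suc dvd_eq_mod_eq_0)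
      qed
      with 1 wt_parent[of c] show ?thesis by (auto simp: abs_le_iff)
    qed
  qed (use assms in \<open>auto simp: pverts_tree\<close>)
  moreover have "att i div D + 1 \<le> att j div D" using assms by simp
  then have "real (att i div D) + 1 \<le> real (att j div D)" by linarith
  ultimately show ?thesis using assms by (simp add: \<phi>_def pos_def)
qed

text \<open>Spine position is a potential that changes by at most 1 on each edge.\<close>

lemma hops_ge:
  assumes "i < n" "j < n"
  shows "real (att j) - real (att i) \<le> length (tree_path tree (M + i) (M + j))"
proof -
  define \<phi> :: "nat \<Rightarrow> real" where "\<phi> v = real (pos v)" for v
  have "\<phi> (M + j) - \<phi> (M + i) \<le> tree_dist tree (\<lambda>_. 1) (M + i) (M + j)"
  proof (rule lipschitz_le_tree_dist)
    fix x y assume "(x, y) \<in> parcs tree"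
    then show "\<phi> y - \<phi> x \<le> 1"
    proof (cases rule: arc_cases)
      case (1 c)
      then show ?thesis using pos_parent[of c] by (auto simp: \<phi>_def)
    qed
  qed (use assms in \<open>auto simp: pverts_tree\<close>)
  then show ?thesis using assms by (simp add: \<phi>_def pos_def tree_dist_one)
qed

lemma tree_dist_parent:
  assumes "c \<in> {..<M + n} - {0}"
  shows "tree_dist tree wt c (parent c) \<le> wt (c, parent c)"
    and "tree_dist tree wt (parent c) c \<le> wt (c, parent c)"
proof -
  have "awalk c [(c, parent c)] (parent c)" "awalk (parent c) [(parent c, c)] c"
    using assms parent_less[OF assms]
    by (auto simp: awalk_Cons_iff awalk_Nil_iff arc_iff pverts_tree)
  from this[THEN tree_dist_le_awalk_cost, of wt]
  show "tree_dist tree wt c (parent c) \<le> wt (c, parent c)"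
    and "tree_dist tree wt (parent c) c \<le> wt (c, parent c)"
    using wt_nonneg wt_parent[OF assms] by auto
qed

text \<open>No multiple of \<open>D\<close> lies in the interval (a, b], so every spine edge passed
  is light.\<close>

lemma tree_dist_same_group:
  assumes "a \<le> b" "b < M" "a div D = b div D"
  shows "tree_dist tree wt a b \<le> (real b - real a) * (\<epsilon> / D)"
  using assms
proof (induction b rule: dec_induct)
  case base
  then show ?case by (simp add: tree_dist_self pverts_tree)
next
  case (step k)
  have "a div D \<le> k div D" "k div D \<le> Suc k div D"
    using step.hyps by (auto intro: div_le_mono)
  then have grp: "a div D = k div D" "Suc k div D = k div D"
    using step.prems by linarith+
  then have "\<not> D dvd Suc k" using width_pos
    by (auto simp: div_Suc dvd_eq_mod_eq_0 split: if_splits)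
  then have "tree_dist tree wt k (Suc k) \<le> \<epsilon> / D"
    using tree_dist_parent(2)[of "Suc k"] wt_parent[of "Suc k"] step.prems by (simp add: parent_def)
  moreover have "tree_dist tree wt a (Suc k) \<le> tree_dist tree wt a k + tree_dist tree wt k (Suc k)"
    using step.hyps step.prems wt_nonneg by (intro tree_dist_triangle) (auto simp: pverts_tree)
  moreover have "tree_dist tree wt a k \<le> (real k - real a) * (\<epsilon> / D)"
    using step.prems grp by (intro step.IH) simp_all
  ultimately show ?case by (simp add: algebra_simps add_divide_distrib)
qed

text \<open>Two leaf edges of weight 1 and at most \<open>D\<close> light spine edges.\<close>

lemma tree_dist_leaves_le:
  assumes "i < n" "j < n" "att i \<le> att j" "att i div D = att j div D"
  shows "tree_dist tree wt (M + i) (M + j) \<le> 2 + \<epsilon>"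
proof -
  have "att j - att i \<le> D"
  proof -
    have "att j = att i div D * D + att j mod D" by (simp add: assms(4))
    moreover have "att i = att i div D * D + att i mod D" by simp
    moreover have "att j mod D < D" using width_pos by simp
    ultimately show ?thesis by linarith
  qed
  then have "(real (att j) - real (att i)) * (\<epsilon> / D) \<le> real D * (\<epsilon> / D)"
    using assms(3) \<epsilon> by (intro mult_right_mono) auto
  then have "tree_dist tree wt (att i) (att j) \<le> \<epsilon>"
    using tree_dist_same_group[of "att i" "att j"] assms att_less[of j] width_pos by simp
  moreover have "tree_dist tree wt (M + i) (att i) \<le> 1" "tree_dist tree wt (att j) (M + j) \<le> 1"
    using tree_dist_parent(1)[of "M + i"] tree_dist_parent(2)[of "M + j"] wt_parent[of "M + i"]
      wt_parent[of "M + j"] assms spine_pos by (auto simp: parent_def)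
  moreover have "tree_dist tree wt (M + i) (M + j) \<le>
     tree_dist tree wt (M + i) (att i) + tree_dist tree wt (att i) (M + j)"
    using assms att_less wt_nonneg by (intro tree_dist_triangle) (auto simp: pverts_tree intro: trans_less_add1)
  moreover have "tree_dist tree wt (att i) (M + j) \<le>
     tree_dist tree wt (att i) (att j) + tree_dist tree wt (att j) (M + j)"
    using assms att_less wt_nonneg by (intro tree_dist_triangle) (auto simp: pverts_tree intro: trans_less_add1)
  ultimately show ?thesis by linarith
qed

end

section \<open>Spanners of the caterpillar\<close>

locale caterpillar_spanner = caterpillar M n D att \<epsilon>
  for M n D :: nat and att :: "nat \<Rightarrow> nat" and \<epsilon> :: real +
  fixes X T' w' G
  assumes spanner: "steiner_spanner (2 - \<epsilon>) tree 0 wt X T' w' G"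
begin

lemma subdivided_tree:
  shows "unique_path_graph T'" "symmetric_positive T' w'" "pverts tree \<subseteq> pverts T'"
    and "\<lbrakk>u \<in> pverts tree; v \<in> pverts tree\<rbrakk> \<Longrightarrow> tree_dist T' w' u v = tree_dist tree wt u v"
    and "\<lbrakk>u \<in> pverts tree; v \<in> pverts tree\<rbrakk> \<Longrightarrow>
      length (tree_path tree u v) \<le> length (tree_path T' u v)"
proof -
  have "steiner_subdivision tree wt T' w'" using spanner by (simp add: steiner_spanner_def)
  from steiner_subdivision_invariant[OF this parent_tree_axioms symmetric_positive_wt]
  obtain par' h' where inv: "parent_tree T' 0 par' h'" "symmetric_positive T' w'"
    "pverts tree \<subseteq> pverts T'"
    "\<And>x y. \<lbrakk>x \<in> pverts tree; y \<in> pverts tree\<rbrakk> \<Longrightarrow> tree_dist T' w' x y = tree_dist tree wt x y \<and>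
       length (tree_path tree x y) \<le> length (tree_path T' x y)"
    by blast
  interpret P: parent_tree T' 0 par' h' by fact
  show "unique_path_graph T'" by (rule P.unique_path_graph_axioms)
  show "symmetric_positive T' w'" "pverts tree \<subseteq> pverts T'"
    and "\<lbrakk>u \<in> pverts tree; v \<in> pverts tree\<rbrakk> \<Longrightarrow> tree_dist T' w' u v = tree_dist tree wt u v"
    and "\<lbrakk>u \<in> pverts tree; v \<in> pverts tree\<rbrakk> \<Longrightarrow>
      length (tree_path tree u v) \<le> length (tree_path T' u v)"
    using inv by auto
qed

sublocale S: unique_path_graph T' by (rule subdivided_tree(1))

sublocale G: pair_graph G using spanner by (simp add: steiner_spanner_def)

abbreviation d :: "nat \<Rightarrow> nat \<Rightarrow> real" where
  "d \<equiv> tree_dist T' w'"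

lemma w'_nonneg: "e \<in> parcs T' \<Longrightarrow> 0 \<le> w' e"
  using symmetric_positiveD(1)[OF subdivided_tree(2), of "fst e" "snd e"] by simp

lemma w'_sym: "(x, y) \<in> parcs T' \<Longrightarrow> w' (x, y) = w' (y, x)"
  using symmetric_positiveD(2)[OF subdivided_tree(2)] .

lemma leaf_in_tree: "i < n \<Longrightarrow> M + i \<in> pverts tree"
  by (simp add: pverts_tree)

lemma leaf_in: "i < n \<Longrightarrow> M + i \<in> pverts T'"
  using leaf_in_tree subdivided_tree(3) by blast

lemma pverts_G: "pverts G = {M..<M + n} \<union> X" "X \<subseteq> pverts T'" "pverts G \<subseteq> pverts T'"
  using spanner leaf_in sites_tree
  by (auto simp: steiner_spanner_def) (metis leaf_in add.commute add_less_cancel_right le_Suc_ex nat_add_left_cancel_less)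

text \<open>The spanner distance is an infimum over walks; a strict bound \<open>B\<close> makes an
  actual walk available.\<close>

lemma spanner_walk:
  assumes "i < n" "j < n" "(2 - \<epsilon>) * d (M + i) (M + j) < B"
  obtains p where "G.awalk (M + i) p (M + j)" "(\<Sum>(x, y)\<leftarrow>p. d x y) < B"
proof -
  have "G.\<mu> (\<lambda>(x, y). d x y) (M + i) (M + j) \<le> ereal ((2 - \<epsilon>) * d (M + i) (M + j))"
    using spanner assms by (simp add: steiner_spanner_def sites_tree)
  also have "\<dots> < ereal B" using assms by simp
  finally show ?thesis
    using that by (auto simp: G.\<mu>_def INF_less_iff G.awalk_cost_def)
qed

text \<open>Only the first link of a walk of cost below 4 needs inspection: its end is neither in
  \<open>X\<close> nor a third leaf. Therefore \<open>far\<close> speaks of the left leaf alone. A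
  site chosen as a Steiner point is covered by \<open>far\<close> as well.\<close>

lemma direct_link:
  assumes ij: "i < n" "j < n" "i \<noteq> j" "att i \<le> att j" "att i div D = att j div D"
    and far: "\<And>x. x \<in> X \<Longrightarrow> 4 \<le> d (M + i) x"
  shows "(M + i, M + j) \<in> parcs G"
proof -
  have "d (M + i) (M + j) \<le> 2 + \<epsilon>"
    using tree_dist_leaves_le ij subdivided_tree(4) leaf_in_tree by simp
  then have "(2 - \<epsilon>) * d (M + i) (M + j) \<le> (2 - \<epsilon>) * (2 + \<epsilon>)"
    using \<epsilon> by (intro mult_left_mono) auto
  \<comment> \<open>The product is 4 minus the square of \<epsilon>.\<close>
  also have "\<dots> < 4" using \<epsilon> by (simp add: algebra_simps)
  finally obtain p where p: "G.awalk (M + i) p (M + j)" "(\<Sum>(x, y)\<leftarrow>p. d x y) < 4"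
    using spanner_walk ij by blast
  from p(1) ij obtain y p' where eq: "p = (M + i, y) # p'" and link: "(M + i, y) \<in> parcs G"
    and p': "G.awalk y p' (M + j)"
    by (cases p) (auto simp: G.awalk_Nil_iff G.awalk_Cons_iff)
  have rest: "d y (M + j) \<le> (\<Sum>(x, y)\<leftarrow>p'. d x y)"
    using p' pverts_G w'_nonneg by (intro S.tree_dist_le_link_cost[OF G.pair_wf_digraph])
  have y: "y \<in> pverts G" "y \<noteq> M + i" using link G.wellformed[OF link] G.no_loops[OF link] by auto
  then have "0 \<le> d y (M + j)"
    using pverts_G leaf_in ij w'_nonneg by (intro S.tree_dist_nonneg) auto
  then have "d (M + i) y < 4" using p(2) rest eq by simp
  then have "y \<in> {M..<M + n}" using y pverts_G far by fastforce
  then obtain l where l: "y = M + l" "l < n" "l \<noteq> i"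
    using y by (metis atLeastLessThan_iff le_Suc_ex nat_add_left_cancel_less)
  have "l = j"
  proof (rule ccontr)
    assume "l \<noteq> j"
    then have "2 \<le> d (M + i) y" "2 \<le> d y (M + j)"
      using tree_dist_leaves_ge_2 subdivided_tree(4) leaf_in_tree ij l by auto
    then show False using p(2) rest eq by simp
  qed
  then show ?thesis using link l by simp
qed

lemma hops_T'_ge:
  assumes "i < n" "j < n"
  shows "real (att j) - real (att i) \<le> length (tree_path T' (M + i) (M + j))"
  using hops_ge[OF assms] subdivided_tree(5)[OF leaf_in_tree leaf_in_tree, OF assms] by linarith

text \<open>\<open>L\<close> may contain just one arc of each opposite pair; this loses only a
  factor of 2.\<close>

lemma spanner_complexity_ge:
  assumes "L \<subseteq> parcs G"
  shows "(\<Sum>(x, y)\<in>L. real (length (tree_path T' x y))) / 2 \<le> spanner_complexity T' G"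
  unfolding spanner_complexity_def
  using assms by (intro divide_right_mono sum_mono2) (auto simp: G.pair_finite_arcs)

text \<open>Already the connectivity of \<open>G\<close> forces this much.\<close>

lemma spanner_complexity_ge_connected:
  assumes "i < n" "j < n"
  shows "(real (att j) - real (att i)) / 2 \<le> spanner_complexity T' G"
proof -
  obtain p where "G.awalk (M + i) p (M + j)"
    using spanner_walk[OF assms, of "(2 - \<epsilon>) * d (M + i) (M + j) + 1"] by auto
  \<comment> \<open>A simple path repeats no arc, so its sum over a list becomes a sum over a set of
    arcs.\<close>
  then obtain q where q: "G.apath (M + i) q (M + j)" using G.apath_awalk_to_apath by blast
  then have q': "G.awalk (M + i) q (M + j)" "set q \<subseteq> parcs G" "distinct q"
    using G.distinct_verts_imp_distinct by (auto simp: G.apath_def G.awalk_def)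
  have "real (att j) - real (att i) \<le> tree_dist T' (\<lambda>_. 1) (M + i) (M + j)"
    using hops_T'_ge[OF assms] by (simp add: S.tree_dist_one)
  also have "\<dots> \<le> (\<Sum>(x, y)\<leftarrow>q. tree_dist T' (\<lambda>_. 1) x y)"
    using q' pverts_G by (intro S.tree_dist_le_link_cost[OF G.pair_wf_digraph]) auto
  also have "\<dots> = (\<Sum>(x, y)\<in>set q. real (length (tree_path T' x y)))"
    using q' by (simp add: sum_list_distinct_conv_sum_set S.tree_dist_one)
  finally show ?thesis using spanner_complexity_ge[OF q'(2)] by simp
qed

text \<open>Two leaves within distance 4 of the same point are less than 8 apart, too close for
  different groups.\<close>

lemma near_unique_group:
  assumes "x \<in> X" "i < n" "j < n" "d (M + i) x < 4" "d (M + j) x < 4"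
  shows "att i div D = att j div D"
proof -
  have *: False if "i < n" "j < n" "d (M + i) x < 4" "d (M + j) x < 4" "att i div D < att j div D" for i j
  proof -
    have "8 \<le> d (M + i) (M + j)"
      using tree_dist_groups_ge_8[of i j] subdivided_tree(4) leaf_in_tree that by simp
    also have "\<dots> \<le> d (M + i) x + d x (M + j)"
      using that leaf_in pverts_G(2) \<open>x \<in> X\<close> w'_nonneg by (intro S.tree_dist_triangle) auto
    also have "d x (M + j) = d (M + j) x"
      using that leaf_in pverts_G(2) \<open>x \<in> X\<close> w'_sym by (intro S.tree_dist_commute) auto
    finally show False using that by simp
  qed
  then show ?thesis using assms by (meson linorder_neqE_nat)
qed

text \<open>Every near group is the image of a Steiner point under the map to its unique group.
  Steiner points near no group have an arbitrary image, which does not affect the inclusion.\<close>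

lemma card_near_groups:
  assumes "finite X"
  shows "card {g. \<exists>i<n. att i div D = g \<and> (\<exists>x\<in>X. d (M + i) x < 4)} \<le> card X"
proof -
  let ?P = "\<lambda>g x. \<exists>i<n. att i div D = g \<and> d (M + i) x < 4"
  have "{g. \<exists>i<n. att i div D = g \<and> (\<exists>x\<in>X. d (M + i) x < 4)} \<subseteq> (\<lambda>x. THE g. ?P g x) ` X"
  proof clarify
    fix i x assume *: "i < n" "x \<in> X" "d (M + i) x < 4"
    have "(THE g. ?P g x) = att i div D"
    proof (rule the_equality)
      show "?P (att i div D) x" using * by blast
      fix g assume "?P g x"
      then obtain j where "j < n" "att j div D = g" "d (M + j) x < 4" by blast
      then show "g = att i div D" using near_unique_group[of x j i] * by simp
    qed
    then show "att i div D \<in> (\<lambda>x. THE g. ?P g x) ` X" using *(2) by (intro image_eqI) auto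
  qed
  from surj_card_le[OF assms this] show ?thesis .
qed

end

section \<open>Counting direct links\<close>

context caterpillar_spanner
begin

text \<open>Group \<open>g\<close> owns a block of \<open>2 * q\<close> consecutive leaves, the
  first \<open>q\<close> at its left end and the others at its right end. At most \<open>k\<close>
  of the \<open>2 * k\<close> groups are near Steiner points; each other one has
  \<open>q * q\<close> direct links of at least \<open>D - 1\<close> hops.\<close>

lemma spanner_complexity_ge_groups:
  fixes q k :: nat
  assumes X: "finite X" "card X = k" and q: "0 < q" and size: "2 * q * (2 * k) \<le> n"
    and left: "\<And>g a. \<lbrakk>g < 2 * k; a < q\<rbrakk> \<Longrightarrow> att (2 * q * g + a) = g * D"
    and right: "\<And>g a. \<lbrakk>g < 2 * k; a < q\<rbrakk> \<Longrightarrow> att (2 * q * g + q + a) = g * D + (D - 1)"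
  shows "real k * (real q)\<^sup>2 * real (D - 1) / 2 \<le> spanner_complexity T' G"
proof -
  define near where "near = {g. \<exists>i<n. att i div D = g \<and> (\<exists>x\<in>X. d (M + i) x < 4)}"
  define free where "free = {..<2 * k} - near"
  have "near \<subseteq> (\<lambda>i. att i div D) ` {..<n}" by (auto simp: near_def)
  then have "finite near" by (rule finite_subset) simp
  \<comment> \<open>\<open>near\<close> may contain groups beyond the first \<open>2 * k\<close>;
    only its cardinality enters.\<close>
  then have "card {..<2 * k} - card near \<le> card free"
    unfolding free_def by (rule diff_card_le_card_Diff)
  then have card_free: "k \<le> card free"
    using card_near_groups[OF X(1)] X(2) by (simp add: near_def)
  have index: "2 * q * g + a < n" "2 * q * g + q + a < n" if "g < 2 * k" "a < q" for g a
  proof -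
    have "2 * q * g + 2 * q \<le> 2 * q * (2 * k)"
      using mult_le_mono2[of "Suc g" "2 * k" "2 * q"] that by simp
    then show "2 * q * g + a < n" "2 * q * g + q + a < n" using size that by linarith+
  qed
  define link where "link = (\<lambda>(g, a, b). (M + (2 * q * g + a), M + (2 * q * g + q + b)))"
  define L where "L = link ` (free \<times> {..<q} \<times> {..<q})"
  have "inj_on link (free \<times> {..<q} \<times> {..<q})"
  proof (rule inj_onI, clarsimp simp: link_def)
    fix g a b g' a' b'
    assume ab: "a < q" "b < q" "a' < q" "b' < q"
      and eq: "2 * q * g + a = 2 * q * g' + a'" "2 * q * g + b = 2 * q * g' + b'"
    have "g = g'"
      \<comment> \<open>Since the offset is below \<open>2 * q\<close>, division recovers the block
        number.\<close>
      using arg_cong[OF eq(1), of "\<lambda>x. x div (2 * q)"] ab by simp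
    then show "g = g' \<and> a = a' \<and> b = b'" using eq by simp
  qed
  then have card_L: "card L = card free * (q * q)"
    unfolding L_def by (subst card_image) (auto simp: card_cartesian_product)
  have L: "e \<in> parcs G \<and> real (D - 1) \<le> (\<lambda>(x, y). real (length (tree_path T' x y))) e"
    if "e \<in> L" for e
  proof -
    from that obtain g a b where e: "e = link (g, a, b)" and g: "g \<in> free" and ab: "a < q" "b < q"
      unfolding L_def by auto
    let ?i = "2 * q * g + a" and ?j = "2 * q * g + q + b"
    from g have g': "g < 2 * k" "g \<notin> near" by (auto simp: free_def)
    have i: "?i < n" "att ?i = g * D" and j: "?j < n" "att ?j = g * D + (D - 1)"
      using index left right g'(1) ab by auto
    have grp: "att ?i div D = g" "att ?j div D = g"
      using width_pos unfolding i(2) j(2) by (simp_all only: div_mult_self3) simp_all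
    have "(M + ?i, M + ?j) \<in> parcs G"
    proof (rule direct_link)
      show "4 \<le> d (M + ?i) x" if "x \<in> X" for x
        using g'(2) that i(1) grp(1) unfolding near_def by (metis (mono_tags, lifting) mem_Collect_eq not_less)
    qed (use i j ab grp in auto)
    moreover have "real (D - 1) \<le> length (tree_path T' (M + ?i) (M + ?j))"
      using hops_T'_ge[OF i(1) j(1)] i(2) j(2) by simp
    ultimately show ?thesis by (simp add: e link_def)
  qed
  have "real k * (real q)\<^sup>2 * real (D - 1) \<le> real (card L) * real (D - 1)"
    using card_free by (auto simp: card_L power2_eq_square intro!: mult_right_mono)
  also have "\<dots> \<le> (\<Sum>(x, y)\<in>L. real (length (tree_path T' x y)))"
    using L by (intro sum_bounded_below) blast
  finally show ?thesis
    using spanner_complexity_ge[of L] L by fastforce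
qed

end

section \<open>Choice of parameters for many and for few leaves\<close>

lemma many_leaves_case:
  fixes \<epsilon> :: real and n k M :: nat
  defines "q \<equiv> (n - 1) div (4 * k)" and "D \<equiv> (M - 1) div (2 * k)"
  defines "att \<equiv> \<lambda>j. if j < 2 * q * (2 * k)
      then (j div (2 * q)) * D + (if j mod (2 * q) < q then 0 else D - 1) else M - 1"
  assumes \<epsilon>: "0 < \<epsilon>" "\<epsilon> < 1" and k: "0 < k" "4 * k < n" and M: "n \<le> M"
  shows "caterpillar M n D att \<epsilon>"
    and "\<lbrakk>caterpillar_spanner M n D att \<epsilon> X T' w' G; card X = k\<rbrakk> \<Longrightarrow>
      1 / 1536 * (real (M + n) * (real n)\<^sup>2 / (real k)\<^sup>2) \<le> spanner_complexity T' G"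
proof -
  have q_pos: "0 < q" using k by (simp add: q_def div_greater_zero_iff)
  have D2: "2 \<le> D" using k M by (simp add: D_def less_eq_div_iff_mult_less_eq)
  \<comment> \<open>Computing \<open>q\<close> from \<open>n - 1\<close> keeps a leaf in reserve for
    the end of the spine; leaves outside the blocks all go there.\<close>
  have q_size: "2 * q * (2 * k) \<le> n - 1"
    unfolding q_def using times_div_less_eq_dividend[of "4 * k" "n - 1"] by (simp add: algebra_simps)
  have D_size: "2 * k * D \<le> M - 1"
    unfolding D_def by (rule times_div_less_eq_dividend)
  show cat: "caterpillar M n D att \<epsilon>"
  proof
    show "\<exists>j<n. att j = M - 1"
      using q_size k by (intro exI[of _ "n - 1"]) (simp add: att_def)
    show "att j < M" if "j < n" for j
    proof (cases "j < 2 * q * (2 * k)")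
      case True
      then have "j div (2 * q) < 2 * k" by (simp add: less_mult_imp_div_less mult.commute)
      then have "Suc (j div (2 * q)) * D \<le> 2 * k * D" by (intro mult_le_mono1) simp
      then have "j div (2 * q) * D + D \<le> M - 1" using D_size by simp
      then show ?thesis using D2 True k M by (auto simp: att_def)
    qed (use k M in \<open>simp add: att_def\<close>)
  qed (use k M D2 \<epsilon> in auto)
  show "1 / 1536 * (real (M + n) * (real n)\<^sup>2 / (real k)\<^sup>2) \<le> spanner_complexity T' G"
    if "caterpillar_spanner M n D att \<epsilon> X T' w' G" and X: "card X = k"
  proof -
    interpret caterpillar_spanner M n D att \<epsilon> X T' w' G by fact
    have bound: "2 * q * g + c < 2 * q * (2 * k)" if "g < 2 * k" "c < 2 * q" for g c
    proof -
      have "2 * q * g + 2 * q \<le> 2 * q * (2 * k)"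
        using mult_le_mono2[of "Suc g" "2 * k" "2 * q"] that by simp
      then show ?thesis using that by linarith
    qed
    have main: "real k * (real q)\<^sup>2 * real (D - 1) / 2 \<le> spanner_complexity T' G"
    proof (rule spanner_complexity_ge_groups)
      \<comment> \<open>An infinite set has cardinality 0, so a positive \<open>k\<close> forces
        finiteness.\<close>
      show "finite X" using X k(1) card_ge_0_finite by blast
      show "att (2 * q * g + a) = g * D" if "g < 2 * k" "a < q" for g a
        using bound[of g a] that by (simp add: att_def)
      show "att (2 * q * g + q + a) = g * D + (D - 1)" if "g < 2 * k" "a < q" for g a
        using bound[of g "q + a"] that by (simp add: att_def add.assoc)
    qed (use X q_pos q_size in auto)
    \<comment> \<open>Rounding costs constant factors: \<open>q + 1\<close> is at most
      \<open>2 * q\<close> as \<open>q\<close> is positive, and below \<open>D + 1\<close> is at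
      most \<open>3 * (D - 1)\<close> as \<open>D\<close> is at least 2.\<close>
    have "n - 1 < 4 * k * (q + 1)"
      using k dividend_less_div_times[of "4 * k" "n - 1"] by (simp add: q_def algebra_simps)
    also have "\<dots> \<le> 4 * k * (2 * q)" using q_pos by (intro mult_le_mono2) simp
    finally have "n \<le> 8 * k * q" by simp
    then have n: "real n \<le> 8 * real k * real q" by (metis of_nat_le_iff of_nat_mult of_nat_numeral)
    have "M - 1 < 2 * k * (D + 1)"
      using k dividend_less_div_times[of "2 * k" "M - 1"] by (simp add: D_def algebra_simps)
    also have "\<dots> \<le> 2 * k * (3 * (D - 1))" using D2 by (intro mult_le_mono2) simp
    finally have "M + n \<le> 12 * k * (D - 1)" using M by simp
    then have m: "real (M + n) \<le> 12 * real k * real (D - 1)"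
      by (metis of_nat_le_iff of_nat_mult of_nat_numeral)
    \<comment> \<open>The constant is 1536 = 12 * 8 * 8 * 2, the last factor undoing the division by
      2 in \<open>main\<close>.\<close>
    have "real (M + n) * (real n)\<^sup>2 \<le> (12 * real k * real (D - 1)) * (8 * real k * real q)\<^sup>2"
      using m n by (intro mult_mono power_mono) auto
    also have "\<dots> = 1536 * (real k)\<^sup>2 * (real k * (real q)\<^sup>2 * real (D - 1) / 2)"
      by (simp add: power2_eq_square)
    also have "\<dots> \<le> 1536 * (real k)\<^sup>2 * spanner_complexity T' G"
      using main by (intro mult_left_mono) auto
    finally show ?thesis using k by (simp add: field_simps)
  qed
qed

text \<open>Here n/k is at most 4, so a bound linear in the number of vertices suffices. Leaf 0 and
  the other leaves sit at opposite ends of the spine, which any connecting walk must cover; groups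
  of width 1 merely fill the parameter.\<close>

lemma few_leaves_case:
  fixes \<epsilon> :: real and n k M :: nat
  defines "att \<equiv> \<lambda>j. if j = 0 then 0 else M - 1"
  assumes \<epsilon>: "0 < \<epsilon>" "\<epsilon> < 1" and k: "0 < k" "2 * k < n" "n \<le> 4 * k" and M: "n \<le> M"
  shows "caterpillar M n 1 att \<epsilon>"
    and "caterpillar_spanner M n 1 att \<epsilon> X T' w' G \<Longrightarrow>
      1 / 1536 * (real (M + n) * (real n)\<^sup>2 / (real k)\<^sup>2) \<le> spanner_complexity T' G"
proof -
  show "caterpillar M n 1 att \<epsilon>"
  proof
    show "\<exists>j<n. att j = M - 1" using k by (intro exI[of _ 1]) (simp add: att_def)
  qed (use k M \<epsilon> in \<open>auto simp: att_def\<close>)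
  assume "caterpillar_spanner M n 1 att \<epsilon> X T' w' G"
  then interpret caterpillar_spanner M n 1 att \<epsilon> X T' w' G .
  have "real (M - 1) / 2 \<le> spanner_complexity T' G"
    using spanner_complexity_ge_connected[of 0 1] k by (simp add: att_def)
  \<comment> \<open>From \<open>0 < k\<close> and \<open>2 * k < n\<close> follows that
    \<open>n\<close>, and hence \<open>M\<close>, is at least 3.\<close>
  moreover have "M + n \<le> 3 * (M - 1)" using k M by linarith
  then have "real (M + n) \<le> 3 * real (M - 1)" by (metis of_nat_le_iff of_nat_mult of_nat_numeral)
  moreover have "(real n)\<^sup>2 / (real k)\<^sup>2 \<le> 16"
  proof -
    have "(real n)\<^sup>2 \<le> (4 * real k)\<^sup>2" using k(3) by (intro power_mono) auto
    then show ?thesis using k by (simp add: field_simps)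
  qed
  then have "real (M + n) * ((real n)\<^sup>2 / (real k)\<^sup>2) \<le> real (M + n) * 16"
    by (rule mult_left_mono) simp
  then have "real (M + n) * (real n)\<^sup>2 / (real k)\<^sup>2 \<le> 16 * real (M + n)" by simp
  moreover have "0 \<le> real (M - 1)" by simp
  ultimately show "1 / 1536 * (real (M + n) * (real n)\<^sup>2 / (real k)\<^sup>2) \<le> spanner_complexity T' G"
    by argo
qed

section \<open>From the caterpillar to the theorem\<close>

lemma caterpillar_witness:
  assumes "caterpillar M n D att \<epsilon>"
    and "\<And>X T' w' G. \<lbrakk>caterpillar_spanner M n D att \<epsilon> X T' w' G; card X = k\<rbrakk> \<Longrightarrow>
      B \<le> spanner_complexity T' G"
  shows "\<exists>(T :: nat pair_pre_digraph) r w.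
     weighted_rooted_tree T r w \<and> card (sites T r) = n \<and> card (pverts T) = M + n \<and>
     (\<forall>X T' w' G. steiner_spanner (2 - \<epsilon>) T r w X T' w' G \<and> card X = k \<longrightarrow>
        B \<le> spanner_complexity T' G)"
proof -
  interpret caterpillar M n D att \<epsilon> by fact
  show ?thesis
  proof (intro exI conjI allI impI)
    show "weighted_rooted_tree tree 0 wt" by (rule weighted_rooted_tree)
    show "card (sites tree 0) = n" "card (pverts tree) = M + n"
      by (simp_all add: sites_tree pverts_tree)
    fix X T' w' G assume *: "steiner_spanner (2 - \<epsilon>) tree 0 wt X T' w' G \<and> card X = k"
    then have "caterpillar_spanner M n D att \<epsilon> X T' w' G" by unfold_locales blast
    then show "B \<le> spanner_complexity T' G" using * by (intro assms(2)) auto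
  qed
qed

theorem lemma3:
  fixes \<epsilon> :: real
  assumes "0 < \<epsilon>" and "\<epsilon> < 1"
  shows "\<exists>c > 0. \<exists>C > 0. \<forall>n m k :: nat.
    0 < n \<and> 0 < m \<and> 0 < k \<and> real k < real n / 2 \<and> real m \<ge> C * real n \<longrightarrow>
    (\<exists>(T :: nat pair_pre_digraph) r w.
       weighted_rooted_tree T r w \<and> card (sites T r) = n \<and> card (pverts T) = m \<and>
       (\<forall>X T' w' G. steiner_spanner (2 - \<epsilon>) T r w X T' w' G \<and> card X = k \<longrightarrow>
          spanner_complexity T' G \<ge> c * (real m * (real n)\<^sup>2 / (real k)\<^sup>2)))"
proof (rule exI[of _ "1 / 1536"], intro conjI)
  show "\<exists>C > 0. \<forall>n m k :: nat.
    0 < n \<and> 0 < m \<and> 0 < k \<and> real k < real n / 2 \<and> real m \<ge> C * real n \<longrightarrow>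
    (\<exists>(T :: nat pair_pre_digraph) r w.
       weighted_rooted_tree T r w \<and> card (sites T r) = n \<and> card (pverts T) = m \<and>
       (\<forall>X T' w' G. steiner_spanner (2 - \<epsilon>) T r w X T' w' G \<and> card X = k \<longrightarrow>
          spanner_complexity T' G \<ge> 1 / 1536 * (real m * (real n)\<^sup>2 / (real k)\<^sup>2)))"
  proof (rule exI[of _ 2], intro conjI allI impI, goal_cases)
    case (2 n m k)
    \<comment> \<open>With C = 2, removing the \<open>n\<close> leaves from \<open>m\<close>
      vertices leaves a spine of at least \<open>n\<close> vertices.\<close>
    define M where "M = m - n"
    have k: "0 < k" "2 * k < n" and M: "n \<le> M" "m = M + n"
      using 2 by (auto simp: M_def)
    show ?case
    proof (cases "4 * k < n")
      case True
      note many = many_leaves_case[OF assms k(1) True M(1)]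
      show ?thesis unfolding M(2) by (rule caterpillar_witness[OF many])
    next
      case False
      then have "n \<le> 4 * k" by simp
      note few = few_leaves_case[OF assms k this M(1)]
      show ?thesis unfolding M(2) by (rule caterpillar_witness[OF few])
    qed
  qed simp
qed simp

end
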